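(* A graph $G$ is threshold if and only if for every (nonempty) induced subgraph $H$ of $G$, $\alpha(H)+\omega(H)=|V(H)|+1$.
   Context: All graphs are simple, finite, and undirected, and have at least one vertex (in particular induced subgraphs are taken on nonempty vertex sets). For a graph $H$, $\alpha(H)$ is the maximum size of a stable set and $\omega(H)$ is the maximum size of a clique. A graph is threshold if there exists an ordering $(v_1,\ldots,v_n)$ of its vertices such that each vertex $v_i$ is either adjacent to all of $v_1,\ldots,v_{i-1}$ or non-adjacent to all of $v_1,\ldots,v_{i-1}$. Induced subgraphs of $G$ include $G$ itself. *)

theory Defs
  imports "Graph_Theory.Digraph_Component"
begin

text \<open>
  Graph_Theory represents a finite simple undirected graph as a finite, loop-free digraph
  without parallel arcs whose arc relation is symmetric (locale \<^locale>\<open>graph\<close>): an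
  undirected edge is a pair of opposite arcs, and adjacency of \<open>u\<close> and \<open>v\<close> is
  \<open>u \<rightarrow>\<^bsub>G\<^esub> v\<close>. The null graph satisfies \<^locale>\<open>graph\<close>, so nonemptiness of the
  vertex set has to be assumed separately.
\<close>

definition stable_set :: "('a, 'b) pre_digraph \<Rightarrow> 'a set \<Rightarrow> bool" where
  "stable_set G S \<longleftrightarrow> S \<subseteq> verts G \<and> pairwise (\<lambda>u v. \<not> u \<rightarrow>\<^bsub>G\<^esub> v) S"

definition clique :: "('a, 'b) pre_digraph \<Rightarrow> 'a set \<Rightarrow> bool" where
  "clique G S \<longleftrightarrow> S \<subseteq> verts G \<and> pairwise (\<lambda>u v. u \<rightarrow>\<^bsub>G\<^esub> v) S"

text \<open>For a finite vertex set both maxima are taken over finite sets containing \<open>0 = card {}\<close>.\<close>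

definition stability_number :: "('a, 'b) pre_digraph \<Rightarrow> nat" where
  "stability_number G = Max (card ` {S. stable_set G S})"

definition clique_number :: "('a, 'b) pre_digraph \<Rightarrow> nat" where
  "clique_number G = Max (card ` {S. clique G S})"

definition threshold :: "('a, 'b) pre_digraph \<Rightarrow> bool" where
  "threshold G \<longleftrightarrow> (\<exists>vs. distinct vs \<and> set vs = verts G \<and>
     (\<forall>i < length vs. (\<forall>j < i. vs ! i \<rightarrow>\<^bsub>G\<^esub> vs ! j) \<or> (\<forall>j < i. \<not> vs ! i \<rightarrow>\<^bsub>G\<^esub> vs ! j)))"

end

theory Submission
  imports Defs
begin

text \<open>
  Both sides of the equivalence are equivalent to the same local condition: every nonempty set of
  vertices contains a vertex that is adjacent to all or to none of the others.

  For a threshold ordering such a vertex is the last member of the set in the ordering; conversely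
  an ordering is obtained by removing such vertices one after another and listing them from the end
  (\<open>threshold_iff_extreme_vertices\<close>).

  The condition gives \<open>\<alpha> + \<omega> = |V| + 1\<close> by induction: adding a vertex adjacent to all others
  raises \<open>\<omega>\<close> by one and keeps \<open>\<alpha>\<close>, and adding a vertex adjacent to no other does the reverse
  (\<open>extreme_vertices_imp_sum\<close>).

  In the other direction only four-vertex subgraphs matter. Suppose \<open>a b\<close> and \<open>c d\<close> are edges while
  \<open>a c\<close> and \<open>b d\<close> are not (an alternating 4-cycle, so that the four vertices induce
  \<open>2K\<^sub>2\<close>, \<open>P\<^sub>4\<close> or \<open>C\<^sub>4\<close>). Any three of the four vertices include both an edge and a non-edge from
  this list, so \<open>\<alpha> + \<omega> \<le> 4 < 5\<close>. Hence the identity excludes alternating 4-cycles. Without them,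
  a vertex of maximum degree is adjacent to all others or has an isolated non-neighbour
  (\<open>extreme_vertex_if_no_alternating_4_cycle\<close>).
\<close>

section \<open>Largest homogeneous sets of a relation\<close>

text \<open>
  Taking \<open>R\<close> to be adjacency gives the clique number of the subgraph induced on \<open>W\<close>, and taking it
  to be non-adjacency gives the stability number, so each argument below serves for both.
\<close>

definition max_pairwise :: "('a \<Rightarrow> 'a \<Rightarrow> bool) \<Rightarrow> 'a set \<Rightarrow> nat" where
  "max_pairwise R W = Max (card ` {S. S \<subseteq> W \<and> pairwise R S})"

lemma card_le_max_pairwise:
  assumes "finite W" "S \<subseteq> W" "pairwise R S"
  shows "card S \<le> max_pairwise R W"
  unfolding max_pairwise_def using assms by (intro Max_ge) auto

lemma max_pairwise_obtain:
  assumes "finite W"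
  obtains S where "S \<subseteq> W" "pairwise R S" "card S = max_pairwise R W"
proof -
  have "max_pairwise R W \<in> card ` {S. S \<subseteq> W \<and> pairwise R S}"
    unfolding max_pairwise_def
    using assms by (intro Max_in) (auto intro!: exI[of _ "{}"] simp: pairwise_def)
  then show thesis using that by auto
qed

lemma max_pairwise_pos:
  assumes "finite W" "W \<noteq> {}"
  shows "0 < max_pairwise R W"
proof -
  obtain w where "w \<in> W" using assms by blast
  then have "card {w} \<le> max_pairwise R W"
    using assms by (intro card_le_max_pairwise) auto
  then show ?thesis by simp
qed

lemma max_pairwise_singleton: "max_pairwise R {v} = 1"
proof -
  obtain S where "S \<subseteq> {v}" "card S = max_pairwise R {v}"
    using max_pairwise_obtain[of "{v}" R] by auto
  then have "max_pairwise R {v} \<le> 1"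
    by (metis card_mono card.empty card_insert_disjoint One_nat_def empty_iff finite.intros)
  then show ?thesis using max_pairwise_pos[of "{v}" R] by simp
qed

lemma max_pairwise_insert_related:
  assumes "finite W" "v \<notin> W" "symp R" "\<And>u. u \<in> W \<Longrightarrow> R v u"
  shows "max_pairwise R (insert v W) = Suc (max_pairwise R W)"
proof (rule antisym)
  obtain S where S: "S \<subseteq> insert v W" "pairwise R S" "card S = max_pairwise R (insert v W)"
    using max_pairwise_obtain[of "insert v W" R] assms(1) by auto
  have "card (S - {v}) \<le> max_pairwise R W"
    using S assms(1) by (intro card_le_max_pairwise) (auto simp: pairwise_def)
  then show "max_pairwise R (insert v W) \<le> Suc (max_pairwise R W)"
    using S(3) card_Diff1_le[of S v] by (simp add: card_Diff_singleton_if split: if_splits)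
next
  obtain S where S: "S \<subseteq> W" "pairwise R S" "card S = max_pairwise R W"
    using max_pairwise_obtain[OF assms(1), of R] by auto
  have "card (insert v S) \<le> max_pairwise R (insert v W)"
    using S assms by (intro card_le_max_pairwise) (auto simp: pairwise_insert dest: sympD)
  moreover have "card (insert v S) = Suc (card S)"
    using S(1) assms(1,2) finite_subset by (subst card_insert_disjoint) auto
  ultimately show "Suc (max_pairwise R W) \<le> max_pairwise R (insert v W)"
    using S(3) by simp
qed

text \<open>Nonemptiness of \<open>W\<close> matters here: \<open>{v}\<close> is itself a homogeneous set of size one.\<close>

lemma max_pairwise_insert_unrelated:
  assumes "finite W" "W \<noteq> {}" "\<And>u. u \<in> W \<Longrightarrow> \<not> R v u"
  shows "max_pairwise R (insert v W) = max_pairwise R W"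
proof (rule antisym)
  obtain S where S: "S \<subseteq> insert v W" "pairwise R S" "card S = max_pairwise R (insert v W)"
    using max_pairwise_obtain[of "insert v W" R] assms(1) by auto
  show "max_pairwise R (insert v W) \<le> max_pairwise R W"
  proof (cases "S \<subseteq> W")
    case True
    then show ?thesis using S card_le_max_pairwise[OF assms(1), of S R] by simp
  next
    case False
    then have "v \<in> S" using S(1) by blast
    have "u = v" if "u \<in> S" for u
      using pairwiseD[OF S(2) \<open>v \<in> S\<close> that] S(1) that assms(3)[of u] by auto
    then have "S = {v}" using \<open>v \<in> S\<close> by blast
    then show ?thesis using S(3) max_pairwise_pos[OF assms(1,2), of R] by simp
  qed
next
  obtain S where S: "S \<subseteq> W" "pairwise R S" "card S = max_pairwise R W"
    using max_pairwise_obtain[OF assms(1), of R] by auto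
  then show "max_pairwise R W \<le> max_pairwise R (insert v W)"
    using card_le_max_pairwise[of "insert v W" S R] assms(1) by auto
qed

section \<open>Vertices related to all or to none of the others\<close>

definition extreme_vertex :: "('a \<Rightarrow> 'a \<Rightarrow> bool) \<Rightarrow> 'a set \<Rightarrow> 'a \<Rightarrow> bool" where
  "extreme_vertex R W v \<longleftrightarrow> v \<in> W \<and> ((\<forall>u\<in>W - {v}. R v u) \<or> (\<forall>u\<in>W - {v}. \<not> R v u))"

text \<open>
  Removing an extreme vertex lowers exactly one of the two maxima, and lowers it by one; a single
  vertex has both maxima equal to one.
\<close>

lemma extreme_vertices_imp_sum:
  assumes "finite W" "W \<noteq> {}" "symp R"
    and "\<And>U. U \<subseteq> W \<Longrightarrow> U \<noteq> {} \<Longrightarrow> \<exists>v. extreme_vertex R U v"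
  shows "max_pairwise (\<lambda>u v. \<not> R u v) W + max_pairwise R W = card W + 1"
  using assms(1,2,4)
proof (induction W rule: finite_psubset_induct)
  case (psubset W)
  let ?N = "\<lambda>u v. \<not> R u v"
  obtain v where v: "extreme_vertex R W v" using psubset.prems by blast
  let ?U = "W - {v}"
  have W: "W = insert v ?U" and fin: "finite ?U"
    using v psubset.hyps by (auto simp: extreme_vertex_def)
  have sym: "symp ?N" using assms(3) by (auto simp: symp_def)
  show ?case
  proof (cases "?U = {}")
    case True
    then have "W = {v}" using W by auto
    then show ?thesis by (simp add: max_pairwise_singleton)
  next
    case False
    have IH: "max_pairwise ?N ?U + max_pairwise R ?U = card ?U + 1"
      using W False psubset.prems(2) by (intro psubset.IH) auto
    have card: "card W = Suc (card ?U)"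
      using fin card_insert_disjoint[of ?U v] W by simp
    consider "\<forall>u\<in>?U. R v u" | "\<forall>u\<in>?U. \<not> R v u"
      using v by (auto simp: extreme_vertex_def)
    then show ?thesis
    proof cases
      case 1
      have "max_pairwise R W = Suc (max_pairwise R ?U)"
        using max_pairwise_insert_related[of ?U v R] fin assms(3) 1 W by simp
      moreover have "max_pairwise ?N W = max_pairwise ?N ?U"
        using max_pairwise_insert_unrelated[of ?U ?N v] fin False 1 W by simp
      ultimately show ?thesis using IH card by simp
    next
      case 2
      have "max_pairwise ?N W = Suc (max_pairwise ?N ?U)"
        using max_pairwise_insert_related[of ?U v ?N] fin sym 2 W by simp
      moreover have "max_pairwise R W = max_pairwise R ?U"
        using max_pairwise_insert_unrelated[of ?U R v] fin False 2 W by simp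
      ultimately show ?thesis using IH card by simp
    qed
  qed
qed

text \<open>
  The witness comes from a vertex \<open>v\<close> of maximum degree. If \<open>v\<close> has a non-neighbour \<open>w\<close> and \<open>w\<close> has
  a neighbour \<open>y\<close>, then any neighbour \<open>z \<noteq> y\<close> of \<open>v\<close> is also a neighbour of \<open>y\<close>, as otherwise
  \<open>v z\<close> and \<open>w y\<close> would be the edges of an alternating 4-cycle. So \<open>y\<close> has all neighbours of \<open>v\<close>
  other than itself and \<open>w\<close> in addition; if \<open>y\<close> is itself a neighbour of \<open>v\<close>, then \<open>v\<close> makes up for
  its absence. Either way \<open>y\<close> has larger degree than \<open>v\<close>, which is impossible, so \<open>w\<close> is isolated.
\<close>

lemma extreme_vertex_if_no_alternating_4_cycle:
  assumes "finite W" "W \<noteq> {}" "symp R" "irreflp R"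
    and no_cycle: "\<And>a b c d. {a, b, c, d} \<subseteq> W \<Longrightarrow> distinct [a, b, c, d] \<Longrightarrow> R a b \<Longrightarrow> R c d \<Longrightarrow>
      \<not> R a c \<Longrightarrow> \<not> R b d \<Longrightarrow> False"
  shows "\<exists>v. extreme_vertex R W v"
proof (rule ccontr)
  assume none: "\<not> ?thesis"
  let ?N = "\<lambda>v. {u \<in> W. R v u}"
  have fin: "finite (?N x)" for x using assms(1) by simp
  have "Max ((\<lambda>v. card (?N v)) ` W) \<in> (\<lambda>v. card (?N v)) ` W"
    using assms(1,2) by (intro Max_in) auto
  then obtain v where v: "v \<in> W" and "card (?N v) = Max ((\<lambda>v. card (?N v)) ` W)"
    by auto
  then have max: "card (?N u) \<le> card (?N v)" if "u \<in> W" for u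
    using that assms(1) by simp
  obtain w where w: "w \<in> W" "w \<noteq> v" "\<not> R v w"
    using none v by (auto simp: extreme_vertex_def)
  obtain y where y: "y \<in> W" "y \<noteq> w" "R w y"
    using none w(1) by (auto simp: extreme_vertex_def)
  have yw: "R y w" using y(3) assms(3) by (auto dest: sympD)
  have "y \<noteq> v" using yw w(3) by auto
  have inherit: "R y z" if "z \<in> ?N v" "z \<noteq> y" for z
  proof (rule ccontr)
    assume "\<not> R y z"
    then have "\<not> R z y" using assms(3) by (auto dest: sympD)
    moreover have "distinct [v, z, w, y]"
      using that w y \<open>y \<noteq> v\<close> assms(4) by (auto simp: irreflp_def)
    ultimately show False
      using no_cycle[of v z w y] that v w y by auto
  qed
  have sub: "insert w (insert v (?N v - {y})) \<subseteq> ?N y" if "R v y"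
    using that v w(1) yw inherit assms(3) by (auto dest: sympD)
  have "card (?N v) < card (?N y)"
  proof (cases "R v y")
    case True
    have "v \<notin> ?N v" using assms(4) by (auto simp: irreflp_def)
    then have "card (insert w (insert v (?N v - {y}))) = Suc (Suc (card (?N v - {y})))"
      using w fin by (subst card_insert_disjoint) auto
    also have "\<dots> = Suc (card (?N v))"
      using True y(1) fin[of v] by (subst card.remove[of "?N v" y]) auto
    finally show ?thesis
      using card_mono[OF fin sub] True by simp
  next
    case False
    then have "insert w (?N v) \<subseteq> ?N y" using w(1) yw inherit by auto
    then have "card (insert w (?N v)) \<le> card (?N y)" by (intro card_mono fin)
    then show ?thesis using w(3) fin[of v] by simp
  qed
  then show False using max[OF y(1)] by simp
qed

text \<open>
  Each of the two disjoint pairs of \<open>R\<close>-related vertices meets an unrelated set at most once, and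
  each of the two disjoint unrelated pairs meets a clique at most once, so both maxima are at most
  two.
\<close>

lemma alternating_4_cycle_sum:
  assumes "distinct [a, b, c, d]" "R a b" "R c d" "\<not> R a c" "\<not> R b d"
  shows "max_pairwise (\<lambda>u v. \<not> R u v) {a, b, c, d} + max_pairwise R {a, b, c, d} \<le> 4"
proof -
  have two: "max_pairwise Q {p, q, r, s} \<le> 2"
    if "distinct [p, q, r, s]" "\<not> Q p q" "\<not> Q r s" for Q :: "'a \<Rightarrow> 'a \<Rightarrow> bool" and p q r s
  proof -
    obtain S where S: "S \<subseteq> {p, q, r, s}" "pairwise Q S" "card S = max_pairwise Q {p, q, r, s}"
      using max_pairwise_obtain[of "{p, q, r, s}" Q] by auto
    have "\<not> {p, q} \<subseteq> S" "\<not> {r, s} \<subseteq> S"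
      using S(2) that by (auto simp: pairwise_def)
    then have "\<exists>x y. S \<subseteq> {x, y}" using S(1) by blast
    then obtain x y where "S \<subseteq> {x, y}" by blast
    then have "card S \<le> card {x, y}" by (intro card_mono) auto
    also have "\<dots> \<le> 2" by (simp add: card_insert_if)
    finally show ?thesis using S(3) by simp
  qed
  have "max_pairwise (\<lambda>u v. \<not> R u v) {a, b, c, d} \<le> 2"
    using two[of a b c d "\<lambda>u v. \<not> R u v"] assms by simp
  moreover have "{a, b, c, d} = {a, c, b, d}" by auto
  then have "max_pairwise R {a, b, c, d} \<le> 2"
    using two[of a c b d R] assms by auto
  ultimately show ?thesis by simp
qed

section \<open>Threshold orderings\<close>

text \<open>
  The ordering is built from the end: an extreme vertex of the whole set goes last.
\<close>

lemma ordering_if_extreme_vertices: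
  assumes "finite W" "\<And>U. U \<subseteq> W \<Longrightarrow> U \<noteq> {} \<Longrightarrow> \<exists>v. extreme_vertex R U v"
  shows "\<exists>vs. distinct vs \<and> set vs = W \<and>
    (\<forall>i < length vs. (\<forall>j < i. R (vs ! i) (vs ! j)) \<or> (\<forall>j < i. \<not> R (vs ! i) (vs ! j)))"
  using assms
proof (induction W rule: finite_psubset_induct)
  case (psubset W)
  show ?case
  proof (cases "W = {}")
    case False
    then obtain v where v: "extreme_vertex R W v" using psubset.prems by blast
    then have "W - {v} \<subset> W" by (auto simp: extreme_vertex_def)
    moreover have "\<exists>u. extreme_vertex R U u" if "U \<subseteq> W - {v}" "U \<noteq> {}" for U
      using that psubset.prems by blast
    ultimately obtain vs where
      vs: "distinct vs" "set vs = W - {v}"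
        "\<forall>i < length vs. (\<forall>j < i. R (vs ! i) (vs ! j)) \<or> (\<forall>j < i. \<not> R (vs ! i) (vs ! j))"
      using psubset.IH[of "W - {v}"] by auto
    have "(\<forall>j < i. R ((vs @ [v]) ! i) ((vs @ [v]) ! j)) \<or>
        (\<forall>j < i. \<not> R ((vs @ [v]) ! i) ((vs @ [v]) ! j))" if "i < length (vs @ [v])" for i
    proof (cases "i < length vs")
      case True
      then show ?thesis using vs(3) by (auto simp: nth_append)
    next
      case False
      then have "i = length vs" using that by simp
      moreover have "vs ! j \<in> W - {v}" if "j < length vs" for j
        using that vs(2) nth_mem by blast
      ultimately show ?thesis
        using v unfolding extreme_vertex_def by (auto simp: nth_append)
    qed
    moreover have "distinct (vs @ [v])" "set (vs @ [v]) = W"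
      using vs v by (auto simp: extreme_vertex_def)
    ultimately show ?thesis by blast
  qed simp
qed

lemma extreme_vertex_if_ordering:
  assumes ord: "\<forall>i < length vs. (\<forall>j < i. R (vs ! i) (vs ! j)) \<or> (\<forall>j < i. \<not> R (vs ! i) (vs ! j))"
    and "U \<subseteq> set vs" "U \<noteq> {}"
  shows "\<exists>v. extreme_vertex R U v"
proof -
  define I where "I = {i. i < length vs \<and> vs ! i \<in> U}"
  define m where "m = Max I"
  have "finite I" by (simp add: I_def)
  have "I \<noteq> {}" using assms(2,3) by (auto simp: I_def in_set_conv_nth subset_iff)
  then have "m \<in> I" unfolding m_def using \<open>finite I\<close> by (intro Max_in)
  then have m: "m < length vs" "vs ! m \<in> U" by (auto simp: I_def)
  have earlier: "\<exists>j < m. u = vs ! j" if u: "u \<in> U - {vs ! m}" for u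
  proof -
    have "u \<in> set vs" using u assms(2) by blast
    then obtain j where j: "j < length vs" "u = vs ! j" by (auto simp: in_set_conv_nth)
    then have "j \<le> m" unfolding m_def using u \<open>finite I\<close> by (intro Max_ge) (auto simp: I_def)
    moreover have "j \<noteq> m" using j u by blast
    ultimately show ?thesis using j(2) by (intro exI[of _ j]) simp
  qed
  from ord m(1) consider "\<forall>j < m. R (vs ! m) (vs ! j)" | "\<forall>j < m. \<not> R (vs ! m) (vs ! j)"
    by blast
  then have "extreme_vertex R U (vs ! m)"
    unfolding extreme_vertex_def using m(2) earlier by cases fastforce+
  then show ?thesis ..
qed

lemma threshold_iff_extreme_vertices:
  assumes "finite (verts G)"
  shows "threshold G \<longleftrightarrow>
    (\<forall>U. U \<subseteq> verts G \<and> U \<noteq> {} \<longrightarrow> (\<exists>v. extreme_vertex (\<lambda>u v. u \<rightarrow>\<^bsub>G\<^esub> v) U v))"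
proof
  assume "threshold G"
  then obtain vs where "set vs = verts G"
    "\<forall>i < length vs. (\<forall>j < i. vs ! i \<rightarrow>\<^bsub>G\<^esub> vs ! j) \<or> (\<forall>j < i. \<not> vs ! i \<rightarrow>\<^bsub>G\<^esub> vs ! j)"
    unfolding threshold_def by blast
  then show "\<forall>U. U \<subseteq> verts G \<and> U \<noteq> {} \<longrightarrow> (\<exists>v. extreme_vertex (\<lambda>u v. u \<rightarrow>\<^bsub>G\<^esub> v) U v)"
    using extreme_vertex_if_ordering[of vs "\<lambda>u v. u \<rightarrow>\<^bsub>G\<^esub> v"] by simp
next
  assume "\<forall>U. U \<subseteq> verts G \<and> U \<noteq> {} \<longrightarrow> (\<exists>v. extreme_vertex (\<lambda>u v. u \<rightarrow>\<^bsub>G\<^esub> v) U v)"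
  then show "threshold G"
    unfolding threshold_def using assms by (intro ordering_if_extreme_vertices) auto
qed

section \<open>Induced subgraphs\<close>

lemma induced_subgraph_dominates_iff:
  assumes "induced_subgraph H G" "u \<in> verts H" "v \<in> verts H"
  shows "u \<rightarrow>\<^bsub>H\<^esub> v \<longleftrightarrow> u \<rightarrow>\<^bsub>G\<^esub> v"
proof -
  have "tail H = tail G" "head H = head G"
    using assms(1) by (auto simp: induced_subgraph_def subgraph_def compatible_def)
  then show ?thesis
    using assms by (auto simp: induced_subgraph_def arcs_ends_conv)
qed

lemma
  assumes "induced_subgraph H G"
  shows stability_number_induced:
      "stability_number H = max_pairwise (\<lambda>u v. \<not> u \<rightarrow>\<^bsub>G\<^esub> v) (verts H)"
    and clique_number_induced:
      "clique_number H = max_pairwise (\<lambda>u v. u \<rightarrow>\<^bsub>G\<^esub> v) (verts H)"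
proof -
  have "stable_set H S \<longleftrightarrow> S \<subseteq> verts H \<and> pairwise (\<lambda>u v. \<not> u \<rightarrow>\<^bsub>G\<^esub> v) S"
    and "clique H S \<longleftrightarrow> S \<subseteq> verts H \<and> pairwise (\<lambda>u v. u \<rightarrow>\<^bsub>G\<^esub> v) S" for S
    unfolding stable_set_def clique_def pairwise_def
    using induced_subgraph_dominates_iff[OF assms] by blast+
  then show "stability_number H = max_pairwise (\<lambda>u v. \<not> u \<rightarrow>\<^bsub>G\<^esub> v) (verts H)"
    and "clique_number H = max_pairwise (\<lambda>u v. u \<rightarrow>\<^bsub>G\<^esub> v) (verts H)"
    unfolding stability_number_def clique_number_def max_pairwise_def by presburger+
qed

theorem theorem1p2:
  fixes G :: "('a, 'b) pre_digraph"
  assumes "graph G" and "verts G \<noteq> {}"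
  shows "threshold G \<longleftrightarrow>
    (\<forall>H. induced_subgraph H G \<and> verts H \<noteq> {} \<longrightarrow>
      stability_number H + clique_number H = card (verts H) + 1)"
proof -
  interpret graph G by fact
  let ?E = "\<lambda>u v. u \<rightarrow>\<^bsub>G\<^esub> v"
  let ?sum = "\<lambda>W. max_pairwise (\<lambda>u v. \<not> ?E u v) W + max_pairwise ?E W"
  have sym: "symp ?E" using sym_arcs by (auto simp: symmetric_def sym_def symp_def)
  have irr: "irreflp ?E" by (auto simp: irreflp_def dest: adj_not_same)
  show ?thesis
  proof
    assume "threshold G"
    then have ext: "\<exists>v. extreme_vertex ?E U v" if "U \<subseteq> verts G" "U \<noteq> {}" for U
      using that threshold_iff_extreme_vertices[of G] by auto
    show "\<forall>H. induced_subgraph H G \<and> verts H \<noteq> {} \<longrightarrow>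
      stability_number H + clique_number H = card (verts H) + 1"
    proof (intro allI impI)
      fix H assume H: "induced_subgraph H G \<and> verts H \<noteq> {}"
      then have sub: "verts H \<subseteq> verts G" by (auto simp: induced_subgraph_def subgraph_def)
      then have "finite (verts H)" using finite_verts finite_subset by blast
      then have "?sum (verts H) = card (verts H) + 1"
        using H sub ext sym by (intro extreme_vertices_imp_sum) auto
      then show "stability_number H + clique_number H = card (verts H) + 1"
        using H by (simp add: stability_number_induced[of H G] clique_number_induced[of H G])
    qed
  next
    assume sums: "\<forall>H. induced_subgraph H G \<and> verts H \<noteq> {} \<longrightarrow>
      stability_number H + clique_number H = card (verts H) + 1"
    have sum: "?sum W = card W + 1" if "W \<subseteq> verts G" "W \<noteq> {}" for W
    proof -
      have ind: "induced_subgraph (G \<restriction> W) G" using that(1) by (rule induced_induce)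
      then show ?thesis
        using sums[rule_format, of "G \<restriction> W"] that(2)
        by (simp add: stability_number_induced[OF ind] clique_number_induced[OF ind])
    qed
    have "\<exists>v. extreme_vertex ?E U v" if U: "U \<subseteq> verts G" "U \<noteq> {}" for U
    proof (rule extreme_vertex_if_no_alternating_4_cycle[OF _ U(2) sym irr])
      show "finite U" using U(1) finite_verts finite_subset by blast
      fix a b c d
      assume "{a, b, c, d} \<subseteq> U" and cyc: "distinct [a, b, c, d]" "?E a b" "?E c d"
        "\<not> ?E a c" "\<not> ?E b d"
      then have "?sum {a, b, c, d} = card {a, b, c, d} + 1" using U(1) by (intro sum) auto
      also have "\<dots> = 5" using cyc(1) by simp
      finally show False using alternating_4_cycle_sum[of a b c d ?E] cyc by simp
    qed
    then show "threshold G" using threshold_iff_extreme_vertices[of G] by auto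
  qed
qed

end
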